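(* Let $\mathcal{S}\subseteq\mathcal{G}$ be a closed subspace satisfying the zero-one law for $\mathcal{L}_{\omega_1,\omega}$-sentences. Then $\mathcal{S}$ contains a comeager elementary equivalence class.
   Context: Space of marked groups: for $n\in\mathbb{N}$, $\mathcal{G}_n$ is the set of pairs $(G,A)$, where $G$ is a group and $A=(a_1,\dots,a_n)$ is an ordered $n$-tuple generating $G$, modulo identifying $(G,(a_1,\dots,a_n))$ with $(H,(b_1,\dots,b_n))$ whenever $a_i\mapsto b_i$ ($i=1,\dots,n$) extends to an isomorphism $G\to H$. For $r\in\mathbb{N}$ write $(G,A)\approx_r(H,B)$ (for elements of $\mathcal{G}_n$) if there is an isomorphism of directed graphs, taking identity to identity, between the balls of radius $r$ around the identity in the Cayley graphs $\Gamma(G,A)$ and $\Gamma(H,B)$ that takes edges labeled by $a_i$ to edges labeled by $b_i$ for all $i$ (the ball of radius $r$ consists of all vertices at distance at most $r$ from the identity and all edges with at least one end at distance at most $r-1$). The sets $\{(H,B)\in\mathcal{G}_n\mid (H,B)\approx_r(G,A)\}$ form a base of the topology of $\mathcal{G}_n$. Identifying $(G,(a_1,\dots,a_n))$ with $(G,(a_1,\dots,a_n,1))$ embeds $\mathcal{G}_n$ in $\mathcal{G}_{n+1}$ as a clopen subset, and $\mathcal{G}=\bigcup_{n}\mathcal{G}_n$ is the topological union; it is a Polish space. $\mathcal{L}$ is the first-order language of groups with signature $\{1,\cdot,{}^{-1}\}$; $\mathcal{L}_{\omega_1,\omega}$ is its infinitary version in which countable conjunctions and disjunctions (but only finite strings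 of quantifiers) are allowed. For an $\mathcal{L}_{\omega_1,\omega}$-sentence $\sigma$, $\mathrm{Mod}_{\mathcal{S}}(\sigma)=\{(G,A)\in\mathcal{S}\mid G\models\sigma\}$. $\mathcal{S}$ satisfies the zero-one law for $\mathcal{L}_{\omega_1,\omega}$-sentences if for every $\mathcal{L}_{\omega_1,\omega}$-sentence $\sigma$ the set $\mathrm{Mod}_{\mathcal{S}}(\sigma)$ is either meager or comeager in $\mathcal{S}$. Two groups are elementarily equivalent if they satisfy the same first-order sentences of $\mathcal{L}$; two elements $(G,A),(H,B)$ of $\mathcal{S}$ are in the same elementary equivalence class if $G$ and $H$ are elementarily equivalent. Comeager means comeager in $\mathcal{S}$. *)

theory Defs
  imports
    "HOL-Analysis.Abstract_Topology"
    "HOL-Algebra.Generated_Groups"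
    "HOL-Library.Countable_Set"
    "HOL-Library.More_List"
begin

section \<open>The space of marked groups\<close>

text \<open>
  A finitely generated group is countable, so carriers can be taken inside \<^typ>\<open>nat\<close>;
  lemma \<open>marked_group_on_nat\<close> below shows that this loses nothing.
\<close>

definition marked_pairs :: "(nat monoid \<times> nat list) set" where
  "marked_pairs = {(G, A). group G \<and> set A \<subseteq> carrier G \<and> generate G (set A) = carrier G}"

text \<open>
  Besides isomorphism of marked groups, this relation identifies \<open>(a\<^sub>1, \<dots>, a\<^sub>n)\<close> with
  \<open>(a\<^sub>1, \<dots>, a\<^sub>n, 1)\<close>: two tuples are compared after padding them with \<open>1\<close>.  On tuples of equal
  length it is isomorphism of marked groups (lemma \<open>marked_rel_same_length\<close>).
\<close>

definition marked_rel :: "((nat monoid \<times> nat list) \<times> (nat monoid \<times> nat list)) set" where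
  "marked_rel = {((G, A), (H, B)). (G, A) \<in> marked_pairs \<and> (H, B) \<in> marked_pairs \<and>
     (\<exists>f \<in> iso G H. \<forall>i. f (nth_default \<one>\<^bsub>G\<^esub> A i) = nth_default \<one>\<^bsub>H\<^esub> B i)}"

type_synonym marked_group = "(nat monoid \<times> nat list) set"

definition marked_groups :: "marked_group set" where
  "marked_groups = marked_pairs // marked_rel"

text \<open>The image of \<open>\<G>\<^sub>n\<close> in the union \<open>\<G>\<close>.\<close>

definition marked_groups_n :: "nat \<Rightarrow> marked_group set" where
  "marked_groups_n n = {marked_rel `` {(G, A)} | G A. (G, A) \<in> marked_pairs \<and> length A = n}"

text \<open>
  A Cayley graph is a directed multigraph: the edge \<open>(g, i, h)\<close> goes from \<open>g\<close> to \<open>h\<close> and is labeled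
  by (the index of) \<open>a\<^sub>i\<close>, so that equal generators at different positions give parallel edges.
\<close>

definition cayley_edges :: "('a, 'm) monoid_scheme \<Rightarrow> 'a list \<Rightarrow> ('a \<times> nat \<times> 'a) set" where
  "cayley_edges G A = {(g, i, g \<otimes>\<^bsub>G\<^esub> (A ! i)) | g i. g \<in> carrier G \<and> i < length A}"

definition cayley_adj :: "('a, 'm) monoid_scheme \<Rightarrow> 'a list \<Rightarrow> ('a \<times> 'a) set" where
  "cayley_adj G A = {(g, h). \<exists>i. (g, i, h) \<in> cayley_edges G A \<or> (h, i, g) \<in> cayley_edges G A}"

definition cayley_ball :: "('a, 'm) monoid_scheme \<Rightarrow> 'a list \<Rightarrow> nat \<Rightarrow> 'a set" where
  "cayley_ball G A r = {g. \<exists>k\<le>r. (\<one>\<^bsub>G\<^esub>, g) \<in> cayley_adj G A ^^ k}"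

text \<open>Distance at most \<open>r - 1\<close> is written as distance less than \<open>r\<close>; in particular the ball of
  radius \<open>0\<close> has no edges.\<close>

definition cayley_ball_edges ::
    "('a, 'm) monoid_scheme \<Rightarrow> 'a list \<Rightarrow> nat \<Rightarrow> ('a \<times> nat \<times> 'a) set" where
  "cayley_ball_edges G A r = {(g, i, h). (g, i, h) \<in> cayley_edges G A \<and>
     (\<exists>k<r. (\<one>\<^bsub>G\<^esub>, g) \<in> cayley_adj G A ^^ k \<or> (\<one>\<^bsub>G\<^esub>, h) \<in> cayley_adj G A ^^ k)}"

text \<open>An edge is determined by its ends and its label, so an isomorphism of labeled balls is given by
  its action on vertices.\<close>

definition approx_r ::
    "nat \<Rightarrow> ('a, 'm) monoid_scheme \<times> 'a list \<Rightarrow> ('b, 'k) monoid_scheme \<times> 'b list \<Rightarrow> bool" where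
  "approx_r r = (\<lambda>(G, A) (H, B). \<exists>f.
     bij_betw f (cayley_ball G A r) (cayley_ball H B r) \<and>
     f \<one>\<^bsub>G\<^esub> = \<one>\<^bsub>H\<^esub> \<and>
     (\<forall>g \<in> cayley_ball G A r. \<forall>h \<in> cayley_ball G A r. \<forall>i.
        (g, i, h) \<in> cayley_ball_edges G A r \<longleftrightarrow> (f g, i, f h) \<in> cayley_ball_edges H B r))"

definition marked_nbhd :: "nat \<Rightarrow> nat monoid \<times> nat list \<Rightarrow> marked_group set" where
  "marked_nbhd r p = {marked_rel `` {q} | q. q \<in> marked_pairs \<and>
     length (snd q) = length (snd p) \<and> approx_r r q p}"

definition marked_topology_n :: "nat \<Rightarrow> marked_group topology" where
  "marked_topology_n n = topology_generated_by
     {marked_nbhd r p | r p. p \<in> marked_pairs \<and> length (snd p) = n}"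

definition marked_topology :: "marked_group topology" where
  "marked_topology = topology (\<lambda>U. U \<subseteq> marked_groups \<and>
     (\<forall>n. openin (marked_topology_n n) (U \<inter> marked_groups_n n)))"

lemma equiv_marked_rel: "equiv marked_pairs marked_rel"
proof (rule equivI)
  show "marked_rel \<subseteq> marked_pairs \<times> marked_pairs"
    by (auto simp: marked_rel_def)
  show "refl_on marked_pairs marked_rel"
    by (auto simp: refl_on_def marked_rel_def intro!: bexI[OF _ id_iso])
  show "sym marked_rel"
  proof (rule symI)
    fix p q assume pq: "(p, q) \<in> marked_rel"
    obtain G A H B where p: "p = (G, A)" and q: "q = (H, B)" by (metis surj_pair)
    from pq obtain f where mem: "(G, A) \<in> marked_pairs" "(H, B) \<in> marked_pairs"
      and f: "f \<in> iso G H" "\<And>i. f (nth_default \<one>\<^bsub>G\<^esub> A i) = nth_default \<one>\<^bsub>H\<^esub> B i"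
      unfolding marked_rel_def p q by auto
    interpret G: group G using mem by (auto simp: marked_pairs_def)
    have in_G: "nth_default \<one>\<^bsub>G\<^esub> A i \<in> carrier G" for i
      using mem(1) by (auto simp: nth_default_def marked_pairs_def)
    have "inj_on f (carrier G)" using f(1) by (auto simp: iso_def bij_betw_def)
    then have "inv_into (carrier G) f (nth_default \<one>\<^bsub>H\<^esub> B i) = nth_default \<one>\<^bsub>G\<^esub> A i" for i
      using inv_into_f_f[OF _ in_G[of i]] f(2)[of i] by metis
    moreover have "inv_into (carrier G) f \<in> iso H G" using f(1) by (rule G.iso_set_sym)
    ultimately show "(q, p) \<in> marked_rel"
      using mem unfolding marked_rel_def p q by auto
  qed
  show "trans marked_rel"
  proof (rule transI)
    fix p q s assume "(p, q) \<in> marked_rel" "(q, s) \<in> marked_rel"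
    moreover obtain G A H B K C where "p = (G, A)" "q = (H, B)" "s = (K, C)"
      by (metis surj_pair)
    moreover have "f \<in> iso G H \<Longrightarrow> g \<in> iso H K \<Longrightarrow> g \<circ> f \<in> iso G K" for f g
      by (rule iso_set_trans)
    ultimately show "(p, s) \<in> marked_rel"
      unfolding marked_rel_def by auto (metis comp_apply)
  qed
qed

lemma marked_rel_same_length:
  assumes "length A = length B"
  shows "((G, A), (H, B)) \<in> marked_rel \<longleftrightarrow>
    (G, A) \<in> marked_pairs \<and> (H, B) \<in> marked_pairs \<and> (\<exists>f \<in> iso G H. map f A = B)"
proof -
  have "(\<forall>i. f (nth_default \<one>\<^bsub>G\<^esub> A i) = nth_default \<one>\<^bsub>H\<^esub> B i) \<longleftrightarrow> map f A = B"
    if "(G, A) \<in> marked_pairs" "(H, B) \<in> marked_pairs" "f \<in> iso G H" for f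
  proof -
    have "f \<one>\<^bsub>G\<^esub> = \<one>\<^bsub>H\<^esub>"
      using that by (auto simp: marked_pairs_def iso_def intro: hom_one)
    then show ?thesis
      using assms by (auto simp: nth_default_def list_eq_iff_nth_eq split: if_splits)
  qed
  then show ?thesis
    unfolding marked_rel_def by auto
qed

lemma openin_marked_topology:
  "openin marked_topology U \<longleftrightarrow> U \<subseteq> marked_groups \<and>
     (\<forall>n. openin (marked_topology_n n) (U \<inter> marked_groups_n n))"
proof -
  let ?P = "\<lambda>U. U \<subseteq> marked_groups \<and> (\<forall>n. openin (marked_topology_n n) (U \<inter> marked_groups_n n))"
  have Int: "?P (S \<inter> T)" if S: "?P S" and T: "?P T" for S T
  proof (intro conjI allI)
    show "S \<inter> T \<subseteq> marked_groups" using S by blast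
    fix n
    have "S \<inter> T \<inter> marked_groups_n n = (S \<inter> marked_groups_n n) \<inter> (T \<inter> marked_groups_n n)"
      by blast
    then show "openin (marked_topology_n n) (S \<inter> T \<inter> marked_groups_n n)"
      using openin_Int[OF conjunct2[OF S, rule_format] conjunct2[OF T, rule_format]] by metis
  qed
  have Un: "?P (\<Union>\<K>)" if K: "\<forall>K\<in>\<K>. ?P K" for \<K>
  proof (intro conjI allI)
    show "\<Union>\<K> \<subseteq> marked_groups" using K by blast
    fix n
    have "openin (marked_topology_n n) (\<Union>((\<lambda>K. K \<inter> marked_groups_n n) ` \<K>))"
      by (rule openin_Union) (use K in blast)
    also have "\<Union>((\<lambda>K. K \<inter> marked_groups_n n) ` \<K>) = \<Union>\<K> \<inter> marked_groups_n n"
      by blast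
    finally show "openin (marked_topology_n n) (\<Union>\<K> \<inter> marked_groups_n n)" .
  qed
  have "istopology ?P"
    unfolding istopology_def using Int Un by blast
  then show ?thesis
    unfolding marked_topology_def by (simp only: topology_inverse')
qed

lemma marked_group_on_nat:
  fixes G :: "('a, 'm) monoid_scheme"
  assumes "group G" "set A \<subseteq> carrier G" "generate G (set A) = carrier G"
  shows "\<exists>H B. (H, B) \<in> marked_pairs \<and> (\<exists>f \<in> iso G H. map f A = B)"
proof -
  interpret group G by fact
  define step where "step = (\<lambda>X. X \<union> m_inv G ` X \<union> (\<lambda>(x, y). x \<otimes>\<^bsub>G\<^esub> y) ` (X \<times> X))"
  define X where "X n = (step ^^ n) (insert \<one>\<^bsub>G\<^esub> (set A))" for n
  have X_Suc: "X (Suc n) = step (X n)" for n by (simp add: X_def)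
  have "mono X"
    by (rule mono_iff_le_Suc[THEN iffD2]) (auto simp: X_Suc step_def)
  have "countable (X n)" for n
    by (induction n) (auto simp: X_Suc step_def X_def[of 0] countable_finite)
  moreover have "g \<in> (\<Union>n. X n)" if "g \<in> generate G (set A)" for g
    using that
  proof induction
    case one then show ?case by (auto simp: X_def intro!: exI[of _ 0])
  next
    case (incl h) then show ?case by (auto simp: X_def intro!: exI[of _ 0])
  next
    case (inv h)
    then have "inv\<^bsub>G\<^esub> h \<in> X (Suc 0)" unfolding X_Suc by (auto simp: X_def step_def)
    then show ?case by blast
  next
    case (eng h1 h2)
    then obtain m n where "h1 \<in> X m" "h2 \<in> X n" by auto
    then have "h1 \<in> X (max m n)" "h2 \<in> X (max m n)"
      using \<open>mono X\<close> by (meson max.cobounded1 max.cobounded2 monoD subsetD)+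
    then have "h1 \<otimes>\<^bsub>G\<^esub> h2 \<in> X (Suc (max m n))" unfolding X_Suc step_def by auto
    then show ?case by blast
  qed
  ultimately have "countable (\<Union>n. X n)" "carrier G \<subseteq> (\<Union>n. X n)"
    using assms(3) by auto
  then have "countable (carrier G)"
    using countable_subset by blast
  then obtain f :: "'a \<Rightarrow> nat" where f: "inj_on f (carrier G)" by (auto simp: countable_def)
  define e where "e = inv_into (carrier G) f"
  have e: "e (f x) = x" if "x \<in> carrier G" for x using f that by (simp add: e_def)
  define H :: "nat monoid" where
    "H = \<lparr>carrier = f ` carrier G, mult = (\<lambda>x y. f (e x \<otimes>\<^bsub>G\<^esub> e y)), one = f \<one>\<^bsub>G\<^esub>\<rparr>"
  have carrier_H: "carrier H = f ` carrier G" by (simp add: H_def)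
  have iso: "f \<in> iso G H"
    using f by (auto simp: iso_def hom_def H_def bij_betw_def e)
  have "group H"
  proof (rule groupI)
    fix x assume "x \<in> carrier H"
    then obtain a where a: "a \<in> carrier G" "x = f a" by (auto simp: H_def)
    then have "f (inv\<^bsub>G\<^esub> a) \<in> carrier H" "f (inv\<^bsub>G\<^esub> a) \<otimes>\<^bsub>H\<^esub> x = \<one>\<^bsub>H\<^esub>"
      by (auto simp: H_def e)
    then show "\<exists>y \<in> carrier H. y \<otimes>\<^bsub>H\<^esub> x = \<one>\<^bsub>H\<^esub>" by blast
  qed (auto simp: H_def e m_assoc)
  moreover have "generate H (set (map f A)) = carrier H"
  proof -
    interpret group_hom G H f
      using iso \<open>group H\<close> assms(1)
      by (simp add: group_hom_def group_hom_axioms_def iso_def)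
    have "generate H (f ` set A) = f ` carrier G"
      using generate_img[of "set A"] assms(2,3) by metis
    then show ?thesis using carrier_H by simp
  qed
  ultimately have "(H, map f A) \<in> marked_pairs"
    using assms(2) by (auto simp: marked_pairs_def carrier_H)
  then show ?thesis using iso by blast
qed


section \<open>The infinitary language of groups\<close>

datatype tm = Var nat | One | Mult tm tm | Inv tm

text \<open>
  A countable conjunction or disjunction is indexed by \<^typ>\<open>nat\<close>; finite ones are obtained by
  repeating members.  A subformula of a sentence lies in the scope of finitely many quantifiers only,
  hence it has finitely many free variables automatically.
\<close>

datatype fm =
    Eq tm tm
  | Neg fm
  | And fm fm
  | Or fm fm
  | All nat fm
  | Ex nat fm
  | Conj "nat \<Rightarrow> fm"
  | Disj "nat \<Rightarrow> fm"

primrec tm_vars :: "tm \<Rightarrow> nat set" where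
  "tm_vars (Var i) = {i}"
| "tm_vars One = {}"
| "tm_vars (Mult s t) = tm_vars s \<union> tm_vars t"
| "tm_vars (Inv t) = tm_vars t"

primrec free_vars :: "fm \<Rightarrow> nat set" where
  "free_vars (Eq s t) = tm_vars s \<union> tm_vars t"
| "free_vars (Neg \<phi>) = free_vars \<phi>"
| "free_vars (And \<phi> \<psi>) = free_vars \<phi> \<union> free_vars \<psi>"
| "free_vars (Or \<phi> \<psi>) = free_vars \<phi> \<union> free_vars \<psi>"
| "free_vars (All i \<phi>) = free_vars \<phi> - {i}"
| "free_vars (Ex i \<phi>) = free_vars \<phi> - {i}"
| "free_vars (Conj \<Phi>) = (\<Union>k. free_vars (\<Phi> k))"
| "free_vars (Disj \<Phi>) = (\<Union>k. free_vars (\<Phi> k))"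

definition sentence :: "fm \<Rightarrow> bool" where
  "sentence \<phi> \<longleftrightarrow> free_vars \<phi> = {}"

primrec first_order :: "fm \<Rightarrow> bool" where
  "first_order (Eq s t) \<longleftrightarrow> True"
| "first_order (Neg \<phi>) \<longleftrightarrow> first_order \<phi>"
| "first_order (And \<phi> \<psi>) \<longleftrightarrow> first_order \<phi> \<and> first_order \<psi>"
| "first_order (Or \<phi> \<psi>) \<longleftrightarrow> first_order \<phi> \<and> first_order \<psi>"
| "first_order (All i \<phi>) \<longleftrightarrow> first_order \<phi>"
| "first_order (Ex i \<phi>) \<longleftrightarrow> first_order \<phi>"
| "first_order (Conj \<Phi>) \<longleftrightarrow> False"
| "first_order (Disj \<Phi>) \<longleftrightarrow> False"

primrec tm_val :: "('a, 'm) monoid_scheme \<Rightarrow> (nat \<Rightarrow> 'a) \<Rightarrow> tm \<Rightarrow> 'a" where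
  "tm_val G v (Var i) = v i"
| "tm_val G v One = \<one>\<^bsub>G\<^esub>"
| "tm_val G v (Mult s t) = tm_val G v s \<otimes>\<^bsub>G\<^esub> tm_val G v t"
| "tm_val G v (Inv t) = inv\<^bsub>G\<^esub> tm_val G v t"

primrec sat :: "('a, 'm) monoid_scheme \<Rightarrow> fm \<Rightarrow> (nat \<Rightarrow> 'a) \<Rightarrow> bool" where
  "sat G (Eq s t) = (\<lambda>v. tm_val G v s = tm_val G v t)"
| "sat G (Neg \<phi>) = (\<lambda>v. \<not> sat G \<phi> v)"
| "sat G (And \<phi> \<psi>) = (\<lambda>v. sat G \<phi> v \<and> sat G \<psi> v)"
| "sat G (Or \<phi> \<psi>) = (\<lambda>v. sat G \<phi> v \<or> sat G \<psi> v)"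
| "sat G (All i \<phi>) = (\<lambda>v. \<forall>g \<in> carrier G. sat G \<phi> (v(i := g)))"
| "sat G (Ex i \<phi>) = (\<lambda>v. \<exists>g \<in> carrier G. sat G \<phi> (v(i := g)))"
| "sat G (Conj \<Phi>) = (\<lambda>v. \<forall>k. sat G (\<Phi> k) v)"
| "sat G (Disj \<Phi>) = (\<lambda>v. \<exists>k. sat G (\<Phi> k) v)"

definition models :: "('a, 'm) monoid_scheme \<Rightarrow> fm \<Rightarrow> bool" where
  "models G \<sigma> \<longleftrightarrow> (\<forall>v. range v \<subseteq> carrier G \<longrightarrow> sat G \<sigma> v)"

definition elem_equiv :: "('a, 'm) monoid_scheme \<Rightarrow> ('b, 'k) monoid_scheme \<Rightarrow> bool" where
  "elem_equiv G H \<longleftrightarrow>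
     (\<forall>\<sigma>. first_order \<sigma> \<and> sentence \<sigma> \<longrightarrow> (models G \<sigma> \<longleftrightarrow> models H \<sigma>))"

text \<open>The next two notions do not depend on the chosen representatives, by lemma \<open>models_iso\<close>.\<close>

definition Mod_in :: "marked_group set \<Rightarrow> fm \<Rightarrow> marked_group set" where
  "Mod_in S \<sigma> = {x \<in> S. \<exists>(G, A) \<in> x. models G \<sigma>}"

definition elem_equiv_on :: "marked_group set \<Rightarrow> (marked_group \<times> marked_group) set" where
  "elem_equiv_on S = {(x, y). x \<in> S \<and> y \<in> S \<and> (\<exists>(G, A) \<in> x. \<exists>(H, B) \<in> y. elem_equiv G H)}"

lemma tm_val_closed:
  assumes "group G" "range v \<subseteq> carrier G"
  shows "tm_val G v t \<in> carrier G"
proof -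
  interpret group G by fact
  show ?thesis using assms(2) by (induction t) auto
qed

lemma tm_val_iso:
  assumes G: "group G" and H: "group H" and f: "f \<in> iso G H" and v: "range v \<subseteq> carrier G"
  shows "tm_val H (f \<circ> v) t = f (tm_val G v t)"
proof -
  interpret group_hom G H f
    using f G H by (auto simp: group_hom_def group_hom_axioms_def iso_def)
  show ?thesis
    by (induction t) (auto simp: tm_val_closed[OF G v])
qed

lemma sat_iso:
  assumes G: "group G" and H: "group H" and f: "f \<in> iso G H" and "range v \<subseteq> carrier G"
  shows "sat H \<phi> (f \<circ> v) \<longleftrightarrow> sat G \<phi> v"
proof -
  have inj: "inj_on f (carrier G)" and surj: "f ` carrier G = carrier H"
    using f by (auto simp: iso_def bij_betw_def)
  have rng: "range (v(i := g)) \<subseteq> carrier G"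
    if "range v \<subseteq> carrier G" "g \<in> carrier G" for v :: "nat \<Rightarrow> _" and i g
    using that by auto
  from assms(4) show ?thesis
  proof (induction \<phi> arbitrary: v)
    case (Eq s t)
    then show ?case
      unfolding sat.simps tm_val_iso[OF G H f Eq] using inj_on_eq_iff[OF inj] tm_val_closed[OF G]
      by blast
  next
    case (All i \<phi>)
    have "sat H (All i \<phi>) (f \<circ> v) \<longleftrightarrow> (\<forall>g \<in> carrier G. sat H \<phi> (f \<circ> v(i := g)))"
      unfolding sat.simps surj[symmetric] fun_upd_comp by blast
    also have "\<dots> \<longleftrightarrow> sat G (All i \<phi>) v"
      unfolding sat.simps using All.IH rng[OF All.prems] by blast
    finally show ?case .
  next
    case (Ex i \<phi>)
    have "sat H (Ex i \<phi>) (f \<circ> v) \<longleftrightarrow> (\<exists>g \<in> carrier G. sat H \<phi> (f \<circ> v(i := g)))"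
      unfolding sat.simps surj[symmetric] fun_upd_comp by blast
    also have "\<dots> \<longleftrightarrow> sat G (Ex i \<phi>) v"
      unfolding sat.simps using Ex.IH rng[OF Ex.prems] by blast
    finally show ?case .
  next
    case (Conj \<Phi>)
    have "sat H (\<Phi> k) (f \<circ> v) \<longleftrightarrow> sat G (\<Phi> k) v" for k using Conj.IH[OF rangeI Conj.prems] .
    then show ?case unfolding sat.simps by blast
  next
    case (Disj \<Phi>)
    have "sat H (\<Phi> k) (f \<circ> v) \<longleftrightarrow> sat G (\<Phi> k) v" for k using Disj.IH[OF rangeI Disj.prems] .
    then show ?case unfolding sat.simps by blast
  next
    case (Neg \<phi>)
    show ?case unfolding sat.simps Neg.IH[OF Neg.prems] ..
  next
    case (And \<phi> \<psi>)
    show ?case unfolding sat.simps And.IH(1)[OF And.prems] And.IH(2)[OF And.prems] ..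
  next
    case (Or \<phi> \<psi>)
    show ?case unfolding sat.simps Or.IH(1)[OF Or.prems] Or.IH(2)[OF Or.prems] ..
  qed
qed

lemma models_iso:
  assumes G: "group G" and H: "group H" and f: "f \<in> iso G H"
  shows "models H \<sigma> \<longleftrightarrow> models G \<sigma>"
proof -
  have surj: "f ` carrier G = carrier H"
    using f by (auto simp: iso_def bij_betw_def)
  have "\<exists>w. range w \<subseteq> carrier G \<and> v = f \<circ> w" if "range v \<subseteq> carrier H" for v :: "nat \<Rightarrow> _"
  proof -
    have "\<forall>i. \<exists>g \<in> carrier G. v i = f g" using that surj by blast
    then obtain w where "\<forall>i. w i \<in> carrier G \<and> v i = f (w i)" by metis
    then show ?thesis by (auto intro!: exI[of _ w])
  qed
  moreover have "range (f \<circ> w) \<subseteq> carrier H" if "range w \<subseteq> carrier G" for w :: "nat \<Rightarrow> _"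
    using that surj by auto
  ultimately show ?thesis
    unfolding models_def using sat_iso[OF G H f] by metis
qed


section \<open>Baire category\<close>

definition nowhere_dense_in :: "'a topology \<Rightarrow> 'a set \<Rightarrow> bool" where
  "nowhere_dense_in X N \<longleftrightarrow> N \<subseteq> topspace X \<and> X interior_of (X closure_of N) = {}"

definition meager_in :: "'a topology \<Rightarrow> 'a set \<Rightarrow> bool" where
  "meager_in X M \<longleftrightarrow> (\<exists>N :: nat \<Rightarrow> 'a set. (\<forall>k. nowhere_dense_in X (N k)) \<and> M = (\<Union>k. N k))"

definition comeager_in :: "'a topology \<Rightarrow> 'a set \<Rightarrow> bool" where
  "comeager_in X C \<longleftrightarrow> C \<subseteq> topspace X \<and> meager_in X (topspace X - C)"

definition zero_one_law :: "marked_group set \<Rightarrow> bool" where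
  "zero_one_law S \<longleftrightarrow> (\<forall>\<sigma>. sentence \<sigma> \<longrightarrow>
     meager_in (subtopology marked_topology S) (Mod_in S \<sigma>) \<or>
     comeager_in (subtopology marked_topology S) (Mod_in S \<sigma>))"

end

theory Submission
  imports Defs
begin

text \<open>
  For every first-order sentence \<open>\<sigma>\<close> the zero-one law makes either \<open>Mod(\<sigma>)\<close> or its complement
  comeager in \<open>S\<close>.  There are only countably many such \<open>\<sigma>\<close>, so the intersection of these comeager
  sets is comeager, and its members all have the same first-order theory.  The Baire category
  theorem is not needed: if the intersection is empty then \<open>S\<close> is meager in itself, every subset
  of \<open>S\<close> is comeager, and any class will do.
\<close>

instance tm :: countable
  by countable_datatype

text \<open>The type \<open>fm\<close> is uncountable because \<open>Conj\<close> and
  \<open>Disj\<close> take arbitrary sequences. This finitary copy has only finite syntax trees, so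
  its countability is automatic; \<open>fm_of\<close> carries it over to the first-order part of
  \<open>fm\<close>.\<close>

datatype fo_fm =
    FEq tm tm
  | FNeg fo_fm
  | FAnd fo_fm fo_fm
  | FOr fo_fm fo_fm
  | FAll nat fo_fm
  | FEx nat fo_fm

instance fo_fm :: countable
  by countable_datatype

primrec fm_of :: "fo_fm \<Rightarrow> fm" where
  "fm_of (FEq s t) = Eq s t"
| "fm_of (FNeg \<phi>) = Neg (fm_of \<phi>)"
| "fm_of (FAnd \<phi> \<psi>) = And (fm_of \<phi>) (fm_of \<psi>)"
| "fm_of (FOr \<phi> \<psi>) = Or (fm_of \<phi>) (fm_of \<psi>)"
| "fm_of (FAll i \<phi>) = All i (fm_of \<phi>)"
| "fm_of (FEx i \<phi>) = Ex i (fm_of \<phi>)"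

lemma first_order_in_range_fm_of:
  assumes "first_order \<phi>"
  shows "\<phi> \<in> range fm_of"
proof -
  have "\<exists>\<psi>. fm_of \<psi> = \<phi>"
    using assms by (induction \<phi>) (auto intro: fm_of.simps)
  then show ?thesis by blast
qed

lemma countable_first_order: "countable {\<phi>. first_order \<phi>}"
  by (rule countable_subset[OF _ countable_image[OF countableI_type]])
    (use first_order_in_range_fm_of in blast)

lemma nowhere_dense_in_subset:
  assumes "nowhere_dense_in X N" "M \<subseteq> N"
  shows "nowhere_dense_in X M"
  using assms interior_of_mono[OF closure_of_mono[OF assms(2)], of X X]
  unfolding nowhere_dense_in_def by auto

lemma meager_in_subset:
  assumes "meager_in X N" "M \<subseteq> N"
  shows "meager_in X M"
proof -
  obtain D where D: "\<And>k :: nat. nowhere_dense_in X (D k)" "N = (\<Union>k. D k)"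
    using assms(1) unfolding meager_in_def by blast
  \<comment> \<open>\<open>meager_in\<close> demands equality with the union of the pieces, so each
    piece is cut down to \<open>M\<close>.\<close>
  have "nowhere_dense_in X (D k \<inter> M)" for k
    using nowhere_dense_in_subset[OF D(1)] by blast
  moreover have "M = (\<Union>k. D k \<inter> M)" using assms(2) D(2) by auto
  ultimately show ?thesis unfolding meager_in_def by (intro exI[of _ "\<lambda>k. D k \<inter> M"]) simp
qed

lemma meager_in_empty: "meager_in X {}"
  unfolding meager_in_def nowhere_dense_in_def by (intro exI[of _ "\<lambda>_. {}"]) auto

lemma meager_in_UN:
  assumes "countable I" "\<And>i. i \<in> I \<Longrightarrow> meager_in X (M i)"
  shows "meager_in X (\<Union>i\<in>I. M i)"
proof (cases "I = {}")
  case True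
  then show ?thesis by (simp add: meager_in_empty)
next
  case False
  have "\<forall>i\<in>I. \<exists>D. (\<forall>k::nat. nowhere_dense_in X (D k)) \<and> M i = (\<Union>k. D k)"
    using assms(2) unfolding meager_in_def by simp
  then obtain D where D: "\<And>i k. i \<in> I \<Longrightarrow> nowhere_dense_in X (D i (k::nat))"
    "\<And>i. i \<in> I \<Longrightarrow> M i = (\<Union>k::nat. D i k)"
    by metis
  \<comment> \<open>The enumeration may repeat indices, which covers finite \<open>I\<close>; it
    exhausts exactly \<open>I\<close> because \<open>I\<close> is nonempty here.\<close>
  define f where "f = from_nat_into I"
  have f: "range f = I"
    unfolding f_def using False assms(1) by (rule range_from_nat_into)
  define E where "E n = (case prod_decode n of (i, k) \<Rightarrow> D (f i) k)" for n
  have "(\<Union>i\<in>I. M i) = (\<Union>n. E n)"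
  proof (intro equalityI subsetI)
    fix x assume "x \<in> (\<Union>i\<in>I. M i)"
    then obtain j k where "x \<in> D (f j) k" using D(2) f by blast
    then have "x \<in> E (prod_encode (j, k))" by (simp add: E_def)
    then show "x \<in> (\<Union>n. E n)" by blast
  next
    fix x assume "x \<in> (\<Union>n. E n)"
    then obtain n where "x \<in> E n" by blast
    then have "x \<in> D (f (fst (prod_decode n))) (snd (prod_decode n))"
      by (simp add: E_def split_beta)
    then show "x \<in> (\<Union>i\<in>I. M i)" using D(2) f by blast
  qed
  moreover have "nowhere_dense_in X (E n)" for n
    using D(1) f by (auto simp: E_def split: prod.split)
  ultimately show ?thesis unfolding meager_in_def by (intro exI[of _ E]) simp
qed

lemma comeager_in_superset:
  assumes "comeager_in X C" "C \<subseteq> D" "D \<subseteq> topspace X"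
  shows "comeager_in X D"
  using assms meager_in_subset[of X "topspace X - C" "topspace X - D"]
  unfolding comeager_in_def by blast

text \<open>Intersecting with \<open>topspace X\<close> matters when \<open>I\<close> is empty,
  since the indexed intersection is then the whole type.\<close>

lemma comeager_in_INT:
  assumes "countable I" "\<And>i. i \<in> I \<Longrightarrow> comeager_in X (C i)"
  shows "comeager_in X (topspace X \<inter> (\<Inter>i\<in>I. C i))"
proof -
  have "topspace X - topspace X \<inter> (\<Inter>i\<in>I. C i) = (\<Union>i\<in>I. topspace X - C i)"
    by blast
  then show ?thesis
    using meager_in_UN[OF assms(1), of X "\<lambda>i. topspace X - C i"] assms(2)
    unfolding comeager_in_def by auto
qed

lemma comeager_in_Compl:
  assumes "meager_in X M" "M \<subseteq> topspace X"
  shows "comeager_in X (topspace X - M)"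
  using assms unfolding comeager_in_def by (simp add: double_diff)

text \<open>\<open>Mod_in\<close> asks for some representative satisfying the sentence. All
  representatives of a point are isomorphic as groups, so any single one decides membership.\<close>

lemma in_Mod_in_iff:
  assumes "S \<subseteq> marked_groups" "x \<in> S" "(G, A) \<in> x"
  shows "x \<in> Mod_in S \<sigma> \<longleftrightarrow> models G \<sigma>"
proof -
  have "x \<in> marked_pairs // marked_rel"
    using assms by (auto simp: marked_groups_def)
  then have rel: "((G, A), (H, B)) \<in> marked_rel" if "(H, B) \<in> x" for H B
    using that assms(3) quotient_eq_iff[OF equiv_marked_rel] by metis
  have "models H \<sigma> \<longleftrightarrow> models G \<sigma>" if "(H, B) \<in> x" for H B
    using rel[OF that] models_iso[of G H _ \<sigma>] by (auto simp: marked_rel_def marked_pairs_def)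
  then show ?thesis using assms(2,3) unfolding Mod_in_def by blast
qed

theorem proposition2p3:
  fixes S :: "marked_group set"
  assumes "closedin marked_topology S"
    and "S \<noteq> {}"
    and "zero_one_law S"
  shows "\<exists>C \<in> S // elem_equiv_on S. comeager_in (subtopology marked_topology S) C"
proof -
  let ?X = "subtopology marked_topology S"
  have "S \<subseteq> topspace marked_topology" using assms(1) by (rule closedin_subset)
  then have top: "topspace ?X = S" and S: "S \<subseteq> marked_groups"
    using openin_marked_topology[of "topspace marked_topology"] by auto
  have class_sub: "elem_equiv_on S `` {x} \<subseteq> topspace ?X" for x
    unfolding top by (auto simp: elem_equiv_on_def)
  define I where "I = {\<sigma>. first_order \<sigma> \<and> sentence \<sigma>}"
  have "countable I"
    by (rule countable_subset[OF _ countable_first_order]) (auto simp: I_def)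
  \<comment> \<open>Whichever of the two sets is chosen, all points of \<open>D \<sigma>\<close>
    agree on the truth of \<open>\<sigma>\<close>.\<close>
  define D where "D \<sigma> = (if comeager_in ?X (Mod_in S \<sigma>) then Mod_in S \<sigma> else S - Mod_in S \<sigma>)"
    for \<sigma>
  have D: "comeager_in ?X (D \<sigma>)" if "\<sigma> \<in> I" for \<sigma>
  proof -
    have "Mod_in S \<sigma> \<subseteq> topspace ?X" unfolding top by (auto simp: Mod_in_def)
    then show ?thesis
      using that assms(3) comeager_in_Compl[of ?X "Mod_in S \<sigma>"]
      unfolding zero_one_law_def I_def D_def top by auto
  qed
  define K where "K = S \<inter> (\<Inter>\<sigma>\<in>I. D \<sigma>)"
  have K: "comeager_in ?X K"
    unfolding K_def using comeager_in_INT[OF \<open>countable I\<close>, of ?X D] D top by simp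
  \<comment> \<open>The conditional choice treats both cases at once: if \<open>K\<close> is empty,
    its inclusion in the class of \<open>x\<close> is trivial.\<close>
  obtain x where x: "x \<in> S" "K \<noteq> {} \<Longrightarrow> x \<in> K"
    using assms(2) by (cases "K = {}") (auto simp: K_def)
  have "K \<subseteq> elem_equiv_on S `` {x}"
  proof
    fix y assume y: "y \<in> K"
    \<comment> \<open>The point \<open>y\<close> witnesses that \<open>K\<close> is nonempty, which
      puts \<open>x\<close> into \<open>K\<close>.\<close>
    then have xy: "x \<in> K" "y \<in> K" "x \<in> S" "y \<in> S" using x by (auto simp: K_def)
    have "x \<noteq> {}" "y \<noteq> {}"
      using xy S in_quotient_imp_non_empty[OF equiv_marked_rel] by (auto simp: marked_groups_def)
    then obtain G A H B where mem: "(G, A) \<in> x" "(H, B) \<in> y"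
      by (metis equals0I surj_pair)
    have "models G \<sigma> \<longleftrightarrow> models H \<sigma>" if "\<sigma> \<in> I" for \<sigma>
    proof -
      have "x \<in> D \<sigma>" "y \<in> D \<sigma>" using xy that unfolding K_def by blast+
      then have "x \<in> Mod_in S \<sigma> \<longleftrightarrow> y \<in> Mod_in S \<sigma>"
        by (auto simp: D_def split: if_splits)
      then show ?thesis
        using in_Mod_in_iff[OF S xy(3) mem(1)] in_Mod_in_iff[OF S xy(4) mem(2)] by simp
    qed
    then have "elem_equiv G H" by (auto simp: elem_equiv_def I_def)
    then show "y \<in> elem_equiv_on S `` {x}"
      using xy mem by (auto simp: elem_equiv_on_def)
  qed
  then have "comeager_in ?X (elem_equiv_on S `` {x})"
    using comeager_in_superset[OF K _ class_sub] by blast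
  then show ?thesis using x(1) by (blast intro: quotientI)
qed

end
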